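(* There are universal constants $\varepsilon_0>0$ and $c>0$ such that for every $0<\varepsilon<\varepsilon_0$ there is an integer $n=n(\varepsilon)\ge 1$ and a bounded set $T_\varepsilon\subseteq\mathbb{R}^n$ with $w(T_\varepsilon)=1$ such that the following holds. If $S\subseteq T_\varepsilon$ is finite and nonempty and $\{c_s\}_{s\in S}$ are real numbers satisfying $$\left\|\sup_{t\in T_\varepsilon} g\cdot t-\max_{s\in S}\{g\cdot s+c_s\}\right\|_{L^2}\le \varepsilon,$$ then $|S|\ge \exp(c/\varepsilon^2)$.
   Context: Here $g\sim N(0,I_n)$ is a standard Gaussian vector in $\mathbb{R}^n$, $\|F\|_{L^2}=\mathbb{E}_{g\sim N(0,I_n)}[|F(g)|^2]^{1/2}$, and $w(T)=\mathbb{E}_{g\sim N(0,I_n)}[\sup_{t\in T}g\cdot t]$ is the Gaussian width of $T$. *)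

theory Defs
  imports "HOL-Probability.Probability"
begin

(* The dimension n is existentially quantified in the theorem, so vectors of R^n are
   functions on {..<n}.  They are required to be extensional (equal to undefined outside
   {..<n}), so that a vector has exactly one representative and the cardinality of a set of
   functions is the cardinality of the set of vectors; this is also the space of PiM. *)

definition euclid :: "nat \<Rightarrow> (nat \<Rightarrow> real) set" where
  "euclid n = {..<n} \<rightarrow>\<^sub>E UNIV"

definition dotp :: "nat \<Rightarrow> (nat \<Rightarrow> real) \<Rightarrow> (nat \<Rightarrow> real) \<Rightarrow> real" where
  "dotp n x y = (\<Sum>i<n. x i * y i)"

definition bounded_in :: "nat \<Rightarrow> (nat \<Rightarrow> real) set \<Rightarrow> bool" where
  "bounded_in n T \<longleftrightarrow> T \<subseteq> euclid n \<and> (\<exists>B. \<forall>t\<in>T. L2_set t {..<n} \<le> B)"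

definition gaussian :: "nat \<Rightarrow> (nat \<Rightarrow> real) measure" where
  "gaussian n = PiM {..<n} (\<lambda>_. std_normal_distribution)"

(* Sup is the supremum on the reals, hence meaningful only for T nonempty and bounded. *)
definition sup_process :: "nat \<Rightarrow> (nat \<Rightarrow> real) set \<Rightarrow> (nat \<Rightarrow> real) \<Rightarrow> real" where
  "sup_process n T g = (SUP t\<in>T. dotp n g t)"

definition gaussian_width :: "nat \<Rightarrow> (nat \<Rightarrow> real) set \<Rightarrow> real" where
  "gaussian_width n T = (\<integral>g. sup_process n T g \<partial>gaussian n)"

(* Bochner integral: the intended value for F square-integrable, as are all Lipschitz F. *)
definition gaussian_L2_norm :: "nat \<Rightarrow> ((nat \<Rightarrow> real) \<Rightarrow> real) \<Rightarrow> real" where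
  "gaussian_L2_norm n F = sqrt (\<integral>g. \<bar>F g\<bar>\<^sup>2 \<partial>gaussian n)"

end

theory Submission
  imports Defs
begin

text \<open>
  The set is the discrete cube \<open>{-r, r}^n\<close> with \<open>n\<close> of order \<open>1 / \<epsilon>\<^sup>2\<close> and \<open>r\<close> chosen to normalise the
  width, so that its points have norm of order \<open>1 / sqrt n\<close>. Let \<open>D\<close> be the difference between the
  supremum over \<open>T\<close> and the approximant. Dilating \<open>g\<close> by \<open>1 + \<delta>\<close> increases the expectation of \<open>D\<close> by
  at least \<open>\<delta> (w(T) - w(S))\<close>. For \<open>\<delta>\<close> of order \<open>1 / sqrt n\<close>, the dilated Gaussian measure has a
  density \<open>L\<close> with \<open>E L\<^sup>2 \<le> 2\<close>, so Cauchy-Schwarz for \<open>E (D (L - 1))\<close> bounds this increase by \<open>\<epsilon>\<close>.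
  Hence \<open>w(S) \<ge> 1/2\<close>, whereas a set of \<open>exp (o(n))\<close> points of norm of order \<open>1 / sqrt n\<close> has width
  \<open>o(1)\<close>.
\<close>

section \<open>Dilations of the Gaussian measure\<close>

lemma prob_space_std_normal: "prob_space std_normal_distribution"
  by (rule prob_space_normal_density) simp

lemma product_prob_space_std_normal: "product_prob_space (\<lambda>_::nat. std_normal_distribution)"
  by (intro product_prob_spaceI prob_space_std_normal)

lemma prob_space_gaussian: "prob_space (gaussian n)"
  unfolding gaussian_def by (intro prob_space_PiM prob_space_std_normal)

lemma sets_gaussian: "sets (gaussian n) = sets (PiM {..<n} (\<lambda>_. borel))"
  unfolding gaussian_def by (intro sets_PiM_cong) auto

lemma space_gaussian: "space (gaussian n) = {..<n} \<rightarrow>\<^sub>E UNIV"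
  unfolding gaussian_def by (simp add: space_PiM)

lemma measurable_gaussian_component [measurable]:
  "i < n \<Longrightarrow> (\<lambda>g. g i) \<in> borel_measurable (gaussian n)"
  unfolding measurable_cong_sets[OF sets_gaussian refl] by measurable

lemma measurable_dotp [measurable]: "(\<lambda>g. dotp n g t) \<in> borel_measurable (gaussian n)"
  unfolding dotp_def by measurable

text \<open>The restriction to \<open>{..<n}\<close> keeps the dilated vector extensional, so that
  \<open>dilate\<close> maps the space of \<open>gaussian n\<close> into itself.\<close>

definition dilate :: "nat \<Rightarrow> real \<Rightarrow> (nat \<Rightarrow> real) \<Rightarrow> (nat \<Rightarrow> real)" where
  "dilate n \<sigma> g = (\<lambda>i\<in>{..<n}. \<sigma> * g i)"

lemma dotp_dilate: "dotp n (dilate n \<sigma> g) t = \<sigma> * dotp n g t"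
  by (simp add: dotp_def dilate_def sum_distrib_left mult.assoc)

lemma measurable_dilate [measurable]: "dilate n \<sigma> \<in> measurable (gaussian n) (gaussian n)"
  unfolding measurable_cong_sets[OF refl sets_gaussian] dilate_def
  by (intro measurable_restrict) auto

text \<open>The likelihood ratio of N(0, \<sigma>^2) to N(0, 1), that is, the quotient of their
  Lebesgue densities.\<close>

definition dilation_ratio :: "real \<Rightarrow> real \<Rightarrow> real" where
  "dilation_ratio \<sigma> x = exp ((1 - 1 / \<sigma>\<^sup>2) * x\<^sup>2 / 2) / \<sigma>"

lemma measurable_dilation_ratio [measurable]: "dilation_ratio \<sigma> \<in> borel_measurable borel"
  unfolding dilation_ratio_def by measurable

lemma dilation_ratio_nonneg: "0 < \<sigma> \<Longrightarrow> 0 \<le> dilation_ratio \<sigma> x"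
  by (simp add: dilation_ratio_def)

text \<open>A scaled standard normal variable is normal with standard deviation \<sigma>, and its
  Lebesgue density factors as \<open>std_normal_density\<close> times
  \<open>dilation_ratio\<close>.\<close>

lemma distr_std_normal_scale:
  assumes "0 < \<sigma>"
  shows "distr std_normal_distribution borel (\<lambda>x. \<sigma> * x) =
         density std_normal_distribution (\<lambda>x. ennreal (dilation_ratio \<sigma> x))"
proof -
  interpret prob_space std_normal_distribution by (rule prob_space_std_normal)
  have "distributed std_normal_distribution lborel (\<lambda>x. x) std_normal_density"
    unfolding distributed_def by (auto intro!: distr_id2)
  from normal_density_affine[OF this, of \<sigma> 0] assms
  have "distr std_normal_distribution lborel (\<lambda>x. \<sigma> * x) = density lborel (normal_density 0 \<sigma>)"
    unfolding distributed_def by simp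
  also have "normal_density 0 \<sigma> = (\<lambda>x. std_normal_density x * dilation_ratio \<sigma> x)"
  proof
    fix x
    have "- x\<^sup>2 / (2 * \<sigma>\<^sup>2) = - x\<^sup>2 / 2 + (1 - 1 / \<sigma>\<^sup>2) * x\<^sup>2 / 2"
      using assms by (simp add: field_simps)
    then show "normal_density 0 \<sigma> x = std_normal_density x * dilation_ratio \<sigma> x"
      using assms
      by (simp add: normal_density_def dilation_ratio_def real_sqrt_mult exp_add[symmetric])
  qed
  also have "density lborel (\<lambda>x. ennreal (std_normal_density x * dilation_ratio \<sigma> x)) =
             density std_normal_distribution (\<lambda>x. ennreal (dilation_ratio \<sigma> x))"
    by (subst density_density_eq) (auto simp: ennreal_mult' intro!: density_cong)
  finally show ?thesis
    by (simp cong: distr_cong)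
qed

text \<open>The density called \<open>L\<close> in the overview: coordinates are independent, so the
  likelihood ratio of the dilated Gaussian is a product.\<close>

definition gaussian_dilation_ratio :: "nat \<Rightarrow> real \<Rightarrow> (nat \<Rightarrow> real) \<Rightarrow> real" where
  "gaussian_dilation_ratio n \<sigma> g = (\<Prod>i<n. dilation_ratio \<sigma> (g i))"

lemma measurable_gaussian_dilation_ratio [measurable]:
  "gaussian_dilation_ratio n \<sigma> \<in> borel_measurable (gaussian n)"
  unfolding gaussian_dilation_ratio_def
  by (intro borel_measurable_prod) (auto intro: measurable_compose[OF _ measurable_dilation_ratio])

lemma gaussian_dilation_ratio_nonneg: "0 < \<sigma> \<Longrightarrow> 0 \<le> gaussian_dilation_ratio n \<sigma> g"
  by (simp add: gaussian_dilation_ratio_def prod_nonneg dilation_ratio_nonneg)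

text \<open>Both sides are the product measure with every factor equal to the scaled normal law
  \<open>N\<close>. A finite product measure is determined by its values on boxes, and there both
  sides factor over the coordinates.\<close>

lemma distr_gaussian_dilate:
  assumes "0 < \<sigma>"
  shows "distr (gaussian n) (gaussian n) (dilate n \<sigma>) =
         density (gaussian n) (\<lambda>g. ennreal (gaussian_dilation_ratio n \<sigma> g))"
proof -
  define N where "N = density std_normal_distribution (\<lambda>x. ennreal (dilation_ratio \<sigma> x))"
  interpret P: product_prob_space "\<lambda>_::nat. std_normal_distribution"
    by (rule product_prob_space_std_normal)
  have N: "N = distr std_normal_distribution borel (\<lambda>x. \<sigma> * x)"
    unfolding N_def by (rule distr_std_normal_scale[OF assms, symmetric])
  have sN [simp]: "sets N = sets borel"
    by (simp add: N_def)
  have "prob_space N"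
    unfolding N by (intro prob_space.prob_space_distr prob_space_std_normal) simp
  then interpret Q: product_prob_space "\<lambda>_::nat. N"
    by (intro product_prob_spaceI)
  have setsQ: "sets (gaussian n) = sets (PiM {..<n} (\<lambda>_. N))"
    unfolding sets_gaussian by (intro sets_PiM_cong) auto
  have box: "Pi\<^sub>E {..<n} A \<in> sets (gaussian n)" if "\<And>i. i \<in> {..<n} \<Longrightarrow> A i \<in> sets N" for A
    unfolding setsQ using that by (intro sets_PiM_I_finite) auto
  have "distr (gaussian n) (gaussian n) (dilate n \<sigma>) = PiM {..<n} (\<lambda>_. N)"
  proof (rule Q.PiM_eqI)
    fix A assume A: "\<And>i. i \<in> {..<n} \<Longrightarrow> A i \<in> sets N"
    have meas: "(\<lambda>x. \<sigma> * x) -` A i \<in> sets borel" if "i < n" for i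
      using A that measurable_sets[of "\<lambda>x. \<sigma> * x" borel borel "A i"] by simp
    have "emeasure (distr (gaussian n) (gaussian n) (dilate n \<sigma>)) (Pi\<^sub>E {..<n} A) =
          emeasure (gaussian n) (dilate n \<sigma> -` Pi\<^sub>E {..<n} A \<inter> space (gaussian n))"
      by (rule emeasure_distr) (use box A in auto)
    also have "dilate n \<sigma> -` Pi\<^sub>E {..<n} A \<inter> space (gaussian n) =
               Pi\<^sub>E {..<n} (\<lambda>i. (\<lambda>x. \<sigma> * x) -` A i)"
      by (auto simp: space_gaussian dilate_def PiE_iff)
    also have "emeasure (gaussian n) \<dots> =
               (\<Prod>i<n. emeasure std_normal_distribution ((\<lambda>x. \<sigma> * x) -` A i))"
      unfolding gaussian_def using meas by (intro P.emeasure_PiM) auto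
    also have "\<dots> = (\<Prod>i<n. emeasure N (A i))"
      unfolding N using A by (intro prod.cong refl) (auto simp: emeasure_distr)
    finally show "emeasure (distr (gaussian n) (gaussian n) (dilate n \<sigma>)) (Pi\<^sub>E {..<n} A) =
                  (\<Prod>i<n. emeasure N (A i))" .
  qed (simp_all add: setsQ)
  moreover have "density (gaussian n) (\<lambda>g. ennreal (gaussian_dilation_ratio n \<sigma> g)) =
                 PiM {..<n} (\<lambda>_. N)"
  proof (rule Q.PiM_eqI)
    fix A assume A: "\<And>i. i \<in> {..<n} \<Longrightarrow> A i \<in> sets N"
    have "emeasure (density (gaussian n) (\<lambda>g. ennreal (gaussian_dilation_ratio n \<sigma> g))) (Pi\<^sub>E {..<n} A) =
          (\<integral>\<^sup>+g. ennreal (gaussian_dilation_ratio n \<sigma> g) * indicator (Pi\<^sub>E {..<n} A) g \<partial>gaussian n)"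
      using box A by (intro emeasure_density) auto
    also have "\<dots> = (\<integral>\<^sup>+g. (\<Prod>i<n. ennreal (dilation_ratio \<sigma> (g i)) * indicator (A i) (g i)) \<partial>gaussian n)"
    proof (rule nn_integral_cong)
      fix g assume "g \<in> space (gaussian n)"
      \<comment> \<open>This uses that \<open>g\<close> lies in the space and so is extensional:
        membership in the box then depends on the coordinates below \<open>n\<close> only.\<close>
      then have "(indicator (Pi\<^sub>E {..<n} A) g :: ennreal) = (\<Prod>i<n. indicator (A i) (g i))"
        by (auto simp: space_gaussian PiE_iff indicator_def prod_zero_iff split: if_splits)
      then show "ennreal (gaussian_dilation_ratio n \<sigma> g) * indicator (Pi\<^sub>E {..<n} A) g =
            (\<Prod>i<n. ennreal (dilation_ratio \<sigma> (g i)) * indicator (A i) (g i))"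
        using assms
        by (simp add: prod.distrib gaussian_dilation_ratio_def prod_ennreal dilation_ratio_nonneg)
    qed
    also have "\<dots> = (\<Prod>i<n. \<integral>\<^sup>+x. ennreal (dilation_ratio \<sigma> x) * indicator (A i) x \<partial>std_normal_distribution)"
      unfolding gaussian_def using A by (intro P.product_nn_integral_prod) auto
    also have "\<dots> = (\<Prod>i<n. emeasure N (A i))"
      unfolding N_def using A by (intro prod.cong refl) (auto simp: emeasure_density)
    finally show "emeasure (density (gaussian n) (\<lambda>g. ennreal (gaussian_dilation_ratio n \<sigma> g))) (Pi\<^sub>E {..<n} A) =
                  (\<Prod>i<n. emeasure N (A i))" .
  qed (simp_all add: setsQ)
  ultimately show ?thesis by simp
qed

section \<open>Second moment of the likelihood ratio\<close>

text \<open>The squared ratio times the standard normal density is a multiple of a centred normal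
  density of variance \<open>v^2\<close>, where \<open>v^2 = \<sigma>^2 / (2 - \<sigma>^2)\<close>;
  it is integrable because \<open>\<sigma>^2 < 2\<close>. The value is written through
  \<open>(\<sigma>^2 - 1)^2\<close> to make visible that it differs from 1 only to second order in
  the dilation.\<close>

lemma has_integral_dilation_ratio_sq:
  assumes "0 < \<sigma>" "\<sigma>\<^sup>2 < 2"
  shows "has_bochner_integral std_normal_distribution (\<lambda>x. (dilation_ratio \<sigma> x)\<^sup>2)
           (1 / sqrt (1 - (\<sigma>\<^sup>2 - 1)\<^sup>2))"
proof -
  define v where "v = \<sigma> / sqrt (2 - \<sigma>\<^sup>2)"
  define C where "C = 1 / sqrt (1 - (\<sigma>\<^sup>2 - 1)\<^sup>2)"
  have v: "0 < v" "v\<^sup>2 = \<sigma>\<^sup>2 / (2 - \<sigma>\<^sup>2)"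
    using assms by (auto simp: v_def power_divide)
  have C: "C = v / \<sigma>\<^sup>2"
  proof -
    have "1 - (\<sigma>\<^sup>2 - 1)\<^sup>2 = \<sigma>\<^sup>2 * (2 - \<sigma>\<^sup>2)"
      by algebra
    then show ?thesis
      using assms by (simp add: C_def v_def real_sqrt_mult power2_eq_square)
  qed
  have eq: "C * normal_density 0 v x = std_normal_density x * (dilation_ratio \<sigma> x)\<^sup>2" for x
  proof -
    have "- x\<^sup>2 / (2 * v\<^sup>2) = - x\<^sup>2 / 2 + (1 - 1 / \<sigma>\<^sup>2) * x\<^sup>2"
      using assms unfolding v by (simp add: field_simps)
    moreover have "(dilation_ratio \<sigma> x)\<^sup>2 = exp ((1 - 1 / \<sigma>\<^sup>2) * x\<^sup>2) / \<sigma>\<^sup>2"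
      by (simp add: dilation_ratio_def power_divide exp_double[symmetric])
    ultimately show ?thesis
      using v(1) by (simp add: normal_density_def C real_sqrt_mult exp_add[symmetric])
  qed
  have "has_bochner_integral lborel (normal_density 0 v) 1"
    using v(1) by (simp add: has_bochner_integral_iff)
  from has_bochner_integral_mult_right[OF this, of C]
  show ?thesis
    unfolding eq C_def[symmetric]
    by (intro has_bochner_integral_density) auto
qed

text \<open>With \<open>q = (\<sigma>^2 - 1)^2\<close>, independence gives the second moment
  \<open>(1 - q)^(-n/2)\<close>, and Bernoulli's inequality gives
  \<open>(1 - q)^n \<ge> 1 - n q \<ge> 1/2\<close>. This is why dilations by
  \<open>1 + \<delta>\<close> with \<delta> of order \<open>1 / sqrt n\<close> are
  affordable.\<close>

lemma gaussian_dilation_ratio_sq: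
  assumes "0 < \<sigma>" "real n * (\<sigma>\<^sup>2 - 1)\<^sup>2 \<le> 1 / 2" "1 \<le> n"
  shows "integrable (gaussian n) (\<lambda>g. (gaussian_dilation_ratio n \<sigma> g)\<^sup>2)"
    and "(\<integral>g. (gaussian_dilation_ratio n \<sigma> g)\<^sup>2 \<partial>gaussian n) \<le> 2"
proof -
  interpret P: product_prob_space "\<lambda>_::nat. std_normal_distribution"
    by (rule product_prob_space_std_normal)
  define q where "q = (\<sigma>\<^sup>2 - 1)\<^sup>2"
  have q: "real n * q \<le> 1 / 2" "0 \<le> q"
    using assms by (auto simp: q_def)
  have "q \<le> 1 / 2"
    using mult_right_mono[of 1 "real n" q] q assms(3) by simp
  moreover have "\<sigma>\<^sup>2 < 2"
  proof (rule ccontr)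
    assume "\<not> \<sigma>\<^sup>2 < 2"
    then have "1 \<le> q" unfolding q_def by (intro one_le_power) simp
    with \<open>q \<le> 1 / 2\<close> show False by simp
  qed
  ultimately have one: "has_bochner_integral std_normal_distribution (\<lambda>x. (dilation_ratio \<sigma> x)\<^sup>2)
      (1 / sqrt (1 - q))"
    unfolding q_def by (intro has_integral_dilation_ratio_sq assms)
  have eq: "(\<lambda>g. (gaussian_dilation_ratio n \<sigma> g)\<^sup>2) = (\<lambda>g. \<Prod>i<n. (dilation_ratio \<sigma> (g i))\<^sup>2)"
    by (simp add: gaussian_dilation_ratio_def prod_power_distrib)
  show "integrable (gaussian n) (\<lambda>g. (gaussian_dilation_ratio n \<sigma> g)\<^sup>2)"
    unfolding eq gaussian_def
    using one by (intro P.product_integrable_prod) (auto simp: has_bochner_integral_iff)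
  have "(\<integral>g. (gaussian_dilation_ratio n \<sigma> g)\<^sup>2 \<partial>gaussian n) = (1 / sqrt (1 - q)) ^ n"
    unfolding eq gaussian_def
    using one by (subst P.product_integral_prod) (auto simp: has_bochner_integral_iff)
  also have "\<dots> = 1 / sqrt ((1 - q) ^ n)"
    by (simp add: power_one_over real_sqrt_power)
  also have "\<dots> \<le> 2"
  proof -
    have "1 / 2 \<le> 1 - real n * q" using q by simp
    also have "\<dots> \<le> (1 - q) ^ n"
      using Bernoulli_inequality[of "- q" n] \<open>q \<le> 1 / 2\<close> by simp
    \<comment> \<open>Weakening 1/2 to 1/4 makes the root rational; this yields the bound 2 in place
      of \<open>sqrt 2\<close>.\<close>
    finally have "sqrt (1 / 4) \<le> sqrt ((1 - q) ^ n)"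
      by (intro real_sqrt_le_mono) simp
    then have "1 / 2 \<le> sqrt ((1 - q) ^ n)"
      by (simp add: real_sqrt_divide)
    then show ?thesis
      using frac_le[of 1 1 "1 / 2" "sqrt ((1 - q) ^ n)"] by simp
  qed
  finally show "(\<integral>g. (gaussian_dilation_ratio n \<sigma> g)\<^sup>2 \<partial>gaussian n) \<le> 2" .
qed

text \<open>Changing variables turns the increment into \<open>E (D (L - 1))\<close>. Since
  \<open>E L = 1\<close>, the second factor satisfies
  \<open>E (L - 1)^2 = E L^2 - 1 \<le> 1\<close>, so the bound is the L2 bound on \<open>D\<close>.
  The integrability statements allow the increment to be compared with other integrals
  later.\<close>

lemma gaussian_dilation_difference:
  fixes D :: "(nat \<Rightarrow> real) \<Rightarrow> real"
  assumes [measurable]: "D \<in> borel_measurable (gaussian n)"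
    and D2: "integrable (gaussian n) (\<lambda>g. (D g)\<^sup>2)"
    and norm: "(\<integral>g. (D g)\<^sup>2 \<partial>gaussian n) \<le> \<epsilon>\<^sup>2" and \<epsilon>: "0 < \<epsilon>"
    and \<sigma>: "0 < \<sigma>" "real n * (\<sigma>\<^sup>2 - 1)\<^sup>2 \<le> 1 / 2" "1 \<le> n"
  shows "integrable (gaussian n) D"
    and "integrable (gaussian n) (\<lambda>g. D (dilate n \<sigma> g))"
    and "(\<integral>g. D (dilate n \<sigma> g) - D g \<partial>gaussian n) \<le> \<epsilon>"
proof -
  interpret prob_space "gaussian n" by (rule prob_space_gaussian)
  let ?L = "gaussian_dilation_ratio n \<sigma>"
  note L2 = gaussian_dilation_ratio_sq[OF \<sigma>]
  have L1: "integrable (gaussian n) ?L"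
    by (rule square_integrable_imp_integrable[OF measurable_gaussian_dilation_ratio L2(1)])
  show D1: "integrable (gaussian n) D"
    by (rule square_integrable_imp_integrable[OF assms(1) D2])
  have distr: "distr (gaussian n) (gaussian n) (dilate n \<sigma>) = density (gaussian n) (\<lambda>g. ennreal (?L g))"
    by (rule distr_gaussian_dilate[OF \<sigma>(1)])
  have DL: "integrable (gaussian n) (\<lambda>g. ?L g * D g)"
  proof (rule Bochner_Integration.integrable_bound)
    show "integrable (gaussian n) (\<lambda>g. (?L g)\<^sup>2 + (D g)\<^sup>2)"
      using L2(1) D2 by simp
    have "\<bar>x * y\<bar> \<le> x\<^sup>2 + y\<^sup>2" for x y :: real
      using sum_squares_bound[of "\<bar>x\<bar>" "\<bar>y\<bar>"] zero_le_power2[of x] zero_le_power2[of y]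
        abs_ge_zero[of "x * y"]
      by (simp only: abs_mult power2_abs)
    then show "AE g in gaussian n. norm (?L g * D g) \<le> norm ((?L g)\<^sup>2 + (D g)\<^sup>2)"
      by simp
  qed simp
  have "integrable (density (gaussian n) (\<lambda>g. ennreal (?L g))) D"
    using DL \<sigma>(1) by (subst integrable_density) (auto simp: gaussian_dilation_ratio_nonneg)
  then show Dd: "integrable (gaussian n) (\<lambda>g. D (dilate n \<sigma> g))"
    unfolding distr[symmetric] by (subst (asm) integrable_distr_eq) auto
  have unit: "(\<integral>g. ?L g \<partial>gaussian n) = 1"
  proof -
    have "(\<integral>g. ?L g * 1 \<partial>gaussian n) = (\<integral>g. 1 \<partial>density (gaussian n) (\<lambda>g. ennreal (?L g)))"
      using \<sigma>(1) by (subst integral_density) (auto simp: gaussian_dilation_ratio_nonneg)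
    also have "\<dots> = (\<integral>g. 1 \<partial>gaussian n)"
      unfolding distr[symmetric] by (subst integral_distr) auto
    finally show ?thesis by (simp add: prob_space)
  qed
  have "(\<integral>g. D (dilate n \<sigma> g) \<partial>gaussian n) = (\<integral>g. ?L g * D g \<partial>gaussian n)"
  proof -
    have "(\<integral>g. D (dilate n \<sigma> g) \<partial>gaussian n) =
          (\<integral>g. D g \<partial>density (gaussian n) (\<lambda>g. ennreal (?L g)))"
      unfolding distr[symmetric] by (subst integral_distr) auto
    also have "\<dots> = (\<integral>g. ?L g * D g \<partial>gaussian n)"
      using \<sigma>(1) by (subst integral_density) (auto simp: gaussian_dilation_ratio_nonneg)
    finally show ?thesis .
  qed
  then have "(\<integral>g. D (dilate n \<sigma> g) - D g \<partial>gaussian n) = (\<integral>g. ?L g * D g - D g \<partial>gaussian n)"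
    using Dd D1 DL by simp
  \<comment> \<open>Cauchy-Schwarz in pointwise form: \<open>D (L - 1) \<le> D^2 / (2 \<epsilon>) +
    \<epsilon> (L - 1)^2 / 2\<close>. The weight \<epsilon> makes each of the two terms contribute
    at most \<open>\<epsilon> / 2\<close>.\<close>
  also have "\<dots> \<le> (\<integral>g. (D g)\<^sup>2 / (2 * \<epsilon>) + \<epsilon> / 2 * ((?L g)\<^sup>2 - 2 * ?L g + 1) \<partial>gaussian n)"
  proof (rule integral_mono)
    fix g
    have "0 \<le> (D g - \<epsilon> * (?L g - 1))\<^sup>2 / (2 * \<epsilon>)"
      using \<epsilon> by simp
    also have "\<dots> = (D g)\<^sup>2 / (2 * \<epsilon>) + \<epsilon> / 2 * ((?L g)\<^sup>2 - 2 * ?L g + 1) - (?L g * D g - D g)"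
      using \<epsilon> by (simp add: field_simps power2_eq_square)
    finally show "?L g * D g - D g \<le> (D g)\<^sup>2 / (2 * \<epsilon>) + \<epsilon> / 2 * ((?L g)\<^sup>2 - 2 * ?L g + 1)"
      by simp
  qed (use D1 DL D2 L1 L2 in auto)
  also have "\<dots> = (\<integral>g. (D g)\<^sup>2 \<partial>gaussian n) / (2 * \<epsilon>) +
      \<epsilon> / 2 * ((\<integral>g. (?L g)\<^sup>2 \<partial>gaussian n) - 1)"
    using D2 L1 L2 unit by (simp add: prob_space)
  also have "\<dots> \<le> \<epsilon>\<^sup>2 / (2 * \<epsilon>) + \<epsilon> / 2 * (2 - 1)"
    using norm L2(2) \<epsilon> by (intro add_mono divide_right_mono mult_left_mono) auto
  also have "\<dots> = \<epsilon>"
    using \<epsilon> by (simp add: power2_eq_square)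
  finally show "(\<integral>g. D (dilate n \<sigma> g) - D g \<partial>gaussian n) \<le> \<epsilon>" .
qed

section \<open>Gaussian width of finite sets\<close>

text \<open>Completing the square: tilting the standard normal density by \<open>exp (u * x)\<close>
  gives \<open>exp (u^2 / 2)\<close> times the density of N(u, 1).\<close>

lemma has_integral_std_normal_mgf:
  "has_bochner_integral std_normal_distribution (\<lambda>x. exp (u * x)) (exp (u\<^sup>2 / 2))"
proof -
  have eq: "exp (u\<^sup>2 / 2) * normal_density u 1 x = std_normal_density x * exp (u * x)" for x
    by (simp add: normal_density_def exp_add[symmetric] power2_eq_square field_simps)
  have "has_bochner_integral lborel (normal_density u 1) 1"
    by (simp add: has_bochner_integral_iff)
  from has_bochner_integral_mult_right[OF this, of "exp (u\<^sup>2 / 2)"]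
  show ?thesis
    unfolding eq by (intro has_bochner_integral_density) auto
qed

lemma has_integral_gaussian_mgf:
  "has_bochner_integral (gaussian n) (\<lambda>g. exp (u * dotp n g t)) (exp (u\<^sup>2 * (\<Sum>i<n. (t i)\<^sup>2) / 2))"
proof -
  interpret P: product_prob_space "\<lambda>_::nat. std_normal_distribution"
    by (rule product_prob_space_std_normal)
  have eq: "(\<lambda>g. exp (u * dotp n g t)) = (\<lambda>g. \<Prod>i<n. exp ((u * t i) * g i))"
    by (simp add: dotp_def sum_distrib_left exp_sum mult_ac)
  have "integrable (gaussian n) (\<lambda>g. \<Prod>i<n. exp ((u * t i) * g i))"
    unfolding gaussian_def using has_integral_std_normal_mgf
    by (intro P.product_integrable_prod) (auto simp: has_bochner_integral_iff)
  moreover have "(\<integral>g. (\<Prod>i<n. exp ((u * t i) * g i)) \<partial>gaussian n) = (\<Prod>i<n. exp ((u * t i)\<^sup>2 / 2))"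
    unfolding gaussian_def using has_integral_std_normal_mgf
    by (subst P.product_integral_prod) (auto simp: has_bochner_integral_iff)
  moreover have "(\<Prod>i<n. exp ((u * t i)\<^sup>2 / 2)) = exp (u\<^sup>2 * (\<Sum>i<n. (t i)\<^sup>2) / 2)"
    by (simp add: exp_sum[symmetric] power_mult_distrib sum_distrib_left sum_divide_distrib)
  ultimately show ?thesis
    unfolding eq by (simp add: has_bochner_integral_iff)
qed

section \<open>Square integrability of maxima of affine functions\<close>

lemma gaussian_component:
  assumes "f \<in> borel_measurable borel" "i < n"
  shows "integrable (gaussian n) (\<lambda>g. f (g i)) \<longleftrightarrow> integrable std_normal_distribution (f :: real \<Rightarrow> real)"
    and "(\<integral>g. f (g i) \<partial>gaussian n) = (\<integral>x. f x \<partial>std_normal_distribution)"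
proof -
  have d: "distr (gaussian n) std_normal_distribution (\<lambda>g. g i) = std_normal_distribution"
    unfolding gaussian_def using assms(2) prob_space_std_normal by (intro distr_PiM_component) auto
  have m: "(\<lambda>g. g i) \<in> measurable (gaussian n) std_normal_distribution"
    using assms by simp
  show "integrable (gaussian n) (\<lambda>g. f (g i)) \<longleftrightarrow> integrable std_normal_distribution f"
    using integrable_distr_eq[OF m, of f] assms unfolding d by simp
  show "(\<integral>g. f (g i) \<partial>gaussian n) = (\<integral>x. f x \<partial>std_normal_distribution)"
    using integral_distr[OF m, of f] assms unfolding d by simp
qed

lemma integrable_square_add:
  fixes f g :: "'a \<Rightarrow> real"
  assumes [measurable]: "f \<in> borel_measurable M" "g \<in> borel_measurable M"
    and "integrable M (\<lambda>x. (f x)\<^sup>2)" "integrable M (\<lambda>x. (g x)\<^sup>2)"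
  shows "integrable M (\<lambda>x. (f x + g x)\<^sup>2)"
proof (rule Bochner_Integration.integrable_bound)
  show "integrable M (\<lambda>x. 2 * (f x)\<^sup>2 + 2 * (g x)\<^sup>2)"
    using assms by simp
  have "(a + b)\<^sup>2 \<le> 2 * a\<^sup>2 + 2 * b\<^sup>2" for a b :: real
    using sum_squares_bound[of a b] by (simp add: power2_sum)
  then show "AE x in M. norm ((f x + g x)\<^sup>2) \<le> norm (2 * (f x)\<^sup>2 + 2 * (g x)\<^sup>2)"
    by simp
qed simp

text \<open>At each point the maximum equals one of the \<open>f s x\<close>, so its square is one
  of the summands of the dominating sum.\<close>

lemma integrable_square_Max:
  fixes f :: "'b \<Rightarrow> 'a \<Rightarrow> real"
  assumes "finite S" "S \<noteq> {}" and [measurable]: "\<And>s. s \<in> S \<Longrightarrow> f s \<in> borel_measurable M"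
    and "\<And>s. s \<in> S \<Longrightarrow> integrable M (\<lambda>x. (f s x)\<^sup>2)"
  shows "integrable M (\<lambda>x. (MAX s\<in>S. f s x)\<^sup>2)"
proof (rule Bochner_Integration.integrable_bound)
  show "integrable M (\<lambda>x. \<Sum>s\<in>S. (f s x)\<^sup>2)"
    using assms by simp
  show "AE x in M. norm ((MAX s\<in>S. f s x)\<^sup>2) \<le> norm (\<Sum>s\<in>S. (f s x)\<^sup>2)"
  proof (rule AE_I2)
    fix x
    have "(MAX s\<in>S. f s x) \<in> (\<lambda>s. f s x) ` S"
      using assms by (intro Max_in) auto
    then obtain s where "s \<in> S" "(MAX s\<in>S. f s x) = f s x" by auto
    then have "(MAX s\<in>S. f s x)\<^sup>2 \<le> (\<Sum>s\<in>S. (f s x)\<^sup>2)"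
      using assms(1) member_le_sum[of s S "\<lambda>s. (f s x)\<^sup>2"] by auto
    then show "norm ((MAX s\<in>S. f s x)\<^sup>2) \<le> norm (\<Sum>s\<in>S. (f s x)\<^sup>2)"
      by (simp add: sum_nonneg)
  qed
qed (use assms in measurable)

lemma integrable_square_dotp: "integrable (gaussian n) (\<lambda>g. (dotp n g t)\<^sup>2)"
proof -
  \<comment> \<open>The induction runs over the partial sums while the measure stays in the fixed
    dimension \<open>n\<close>.\<close>
  have "integrable (gaussian n) (\<lambda>g. (\<Sum>i<m. g i * t i)\<^sup>2)" if "m \<le> n" for m
    using that
  proof (induction m)
    case (Suc m)
    have "integrable (gaussian n) (\<lambda>g. (g m)\<^sup>2)"
      using Suc.prems integrable_std_normal_distribution_moment[of 2] by (subst gaussian_component) auto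
    then have "integrable (gaussian n) (\<lambda>g. (g m * t m)\<^sup>2)"
      by (simp add: power_mult_distrib)
    moreover have "(\<lambda>g. \<Sum>i<m. g i * t i) \<in> borel_measurable (gaussian n)"
      using Suc.prems by (intro borel_measurable_sum borel_measurable_times) auto
    moreover have "(\<lambda>g. g m * t m) \<in> borel_measurable (gaussian n)"
      using Suc.prems by (intro borel_measurable_times) auto
    ultimately show ?case
      using Suc by (auto intro!: integrable_square_add)
  qed simp
  then show ?thesis by (simp add: dotp_def)
qed

lemma integrable_square_affine: "integrable (gaussian n) (\<lambda>g. (dotp n g t + b)\<^sup>2)"
proof -
  interpret prob_space "gaussian n" by (rule prob_space_gaussian)
  show ?thesis by (intro integrable_square_add integrable_square_dotp) auto
qed

lemma measurable_Max_affine: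
  assumes "finite S"
  shows "(\<lambda>g. MAX s\<in>S. dotp n g s + a s) \<in> borel_measurable (gaussian n)"
  using assms by (intro borel_measurable_Max) auto

lemma integrable_square_Max_affine:
  assumes "finite S" "S \<noteq> {}"
  shows "integrable (gaussian n) (\<lambda>g. (MAX s\<in>S. dotp n g s + a s)\<^sup>2)"
  using assms by (intro integrable_square_Max integrable_square_affine) auto

lemma integrable_Max_dotp:
  assumes "finite S" "S \<noteq> {}"
  shows "integrable (gaussian n) (\<lambda>g. MAX s\<in>S. dotp n g s)"
proof -
  interpret prob_space "gaussian n" by (rule prob_space_gaussian)
  have "integrable (gaussian n) (\<lambda>g. MAX s\<in>S. dotp n g s + 0)"
    by (rule square_integrable_imp_integrable[OF measurable_Max_affine integrable_square_Max_affine])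
      (rule assms)+
  then show ?thesis by simp
qed

section \<open>Expected maximum of finitely many Gaussian variables\<close>

lemma sup_process_finite: "finite T \<Longrightarrow> T \<noteq> {} \<Longrightarrow> sup_process n T g = (MAX t\<in>T. dotp n g t)"
  unfolding sup_process_def by (simp add: cSup_eq_Max)

text \<open>The exponential moment bound: \<open>exp (u * max)\<close> is at most the sum of the
  \<open>exp (u * dotp n g s)\<close>, whose expectation is at most
  \<open>card S * exp (u^2 * r / 2)\<close>. Here \<open>r\<close> bounds the squared norms, and
  \<open>u\<close> is left free to be optimised.\<close>

lemma gaussian_width_finite_le:
  assumes S: "finite S" "S \<noteq> {}" and r: "\<And>s. s \<in> S \<Longrightarrow> (\<Sum>i<n. (s i)\<^sup>2) \<le> r" and "0 < u"
  shows "gaussian_width n S \<le> (ln (card S) + u\<^sup>2 * r / 2) / u"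
proof -
  interpret prob_space "gaussian n" by (rule prob_space_gaussian)
  \<comment> \<open>The logarithm of the bound on the summed moment generating functions; with this
    tangent point the exponential term has expectation at most 1, which cancels the
    \<open>- 1\<close>.\<close>
  define b where "b = ln (card S) + u\<^sup>2 * r / 2"
  define m where "m = (\<lambda>g. MAX s\<in>S. dotp n g s)"
  have card: "0 < real (card S)"
    using S by (simp add: card_gt_0_iff)
  have int: "integrable (gaussian n) (\<lambda>g. exp (u * dotp n g s))" for s
    using has_integral_gaussian_mgf by (auto simp: has_bochner_integral_iff)
  text \<open>The tangent line inequality \<open>x \<le> b + exp (x - b) - 1\<close> replaces Jensen's inequality.\<close>
  have "u * (\<integral>g. m g \<partial>gaussian n) = (\<integral>g. u * m g \<partial>gaussian n)"
    by simp
  also have "\<dots> \<le> (\<integral>g. (b - 1) + exp (- b) * (\<Sum>s\<in>S. exp (u * dotp n g s)) \<partial>gaussian n)"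
  proof (rule integral_mono)
    fix g
    have "m g \<in> (\<lambda>s. dotp n g s) ` S"
      unfolding m_def using S by (intro Max_in) auto
    then obtain s where s: "s \<in> S" "m g = dotp n g s" by auto
    have "u * m g \<le> (b - 1) + exp (u * m g - b)"
      using exp_ge_add_one_self[of "u * m g - b"] by linarith
    also have "exp (u * m g - b) = exp (- b) * exp (u * dotp n g s)"
      by (simp add: s exp_diff exp_minus field_simps)
    also have "\<dots> \<le> exp (- b) * (\<Sum>s\<in>S. exp (u * dotp n g s))"
      using S s by (intro mult_left_mono member_le_sum) auto
    finally show "u * m g \<le> (b - 1) + exp (- b) * (\<Sum>s\<in>S. exp (u * dotp n g s))" by simp
  qed (use int integrable_Max_dotp[OF S] in \<open>auto simp: m_def\<close>)
  also have "\<dots> = (b - 1) + exp (- b) * (\<Sum>s\<in>S. exp (u\<^sup>2 * (\<Sum>i<n. (s i)\<^sup>2) / 2))"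
    using int has_integral_gaussian_mgf by (simp add: has_bochner_integral_iff prob_space)
  also have "\<dots> \<le> (b - 1) + exp (- b) * (\<Sum>s\<in>S. exp (u\<^sup>2 * r / 2))"
    using r by (intro add_left_mono mult_left_mono sum_mono) (auto intro!: mult_left_mono)
  also have "(\<Sum>s\<in>S. exp (u\<^sup>2 * r / 2)) = exp b"
    using card by (simp add: b_def exp_add)
  also have "(b - 1) + exp (- b) * exp b = b"
    by (simp add: exp_minus)
  finally have "u * (\<integral>g. m g \<partial>gaussian n) \<le> b" .
  then show ?thesis
    using \<open>0 < u\<close> S by (simp add: gaussian_width_def sup_process_finite m_def b_def field_simps)
qed

section \<open>Approximation of the maximum over a finite set\<close>

text \<open>Dilating by \<open>\<sigma>\<close> increases \<open>sup_process n T\<close> by the full factor \<open>\<sigma>\<close>, but an approximant over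
  \<open>S\<close> by at most \<open>(\<sigma> - 1) * sup_process n S\<close>, whatever the offsets are.\<close>

lemma gaussian_width_gap:
  assumes T: "finite T" "T \<noteq> {}" and S: "finite S" "S \<noteq> {}"
    and approx: "gaussian_L2_norm n (\<lambda>g. sup_process n T g - (MAX s\<in>S. dotp n g s + a s)) \<le> \<epsilon>"
    and \<epsilon>: "0 < \<epsilon>" and \<sigma>: "1 \<le> \<sigma>" "real n * (\<sigma>\<^sup>2 - 1)\<^sup>2 \<le> 1 / 2" "1 \<le> n"
  shows "(\<sigma> - 1) * (gaussian_width n T - gaussian_width n S) \<le> \<epsilon>"
proof -
  define h where "h = (\<lambda>g. MAX s\<in>S. dotp n g s + a s)"
  define D where "D = (\<lambda>g. sup_process n T g - h g)"
  have sup_dilate: "sup_process n T (dilate n \<sigma> g) = \<sigma> * sup_process n T g" for g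
  proof -
    have "(\<lambda>t. dotp n (dilate n \<sigma> g) t) ` T = (*) \<sigma> ` (\<lambda>t. dotp n g t) ` T"
      by (simp add: image_image dotp_dilate)
    moreover have "mono ((*) \<sigma>)"
      using \<sigma>(1) by (intro monoI mult_left_mono) auto
    ultimately show ?thesis
      using T by (simp add: sup_process_finite mono_Max_commute)
  qed
  have h_dilate: "h (dilate n \<sigma> g) \<le> h g + (\<sigma> - 1) * sup_process n S g" for g
    unfolding h_def
  proof (rule Max.boundedI)
    fix y assume "y \<in> (\<lambda>s. dotp n (dilate n \<sigma> g) s + a s) ` S"
    then obtain s where s: "s \<in> S" "y = (dotp n g s + a s) + (\<sigma> - 1) * dotp n g s"
      by (auto simp: dotp_dilate algebra_simps)
    have "dotp n g s + a s \<le> (MAX s\<in>S. dotp n g s + a s)" "dotp n g s \<le> sup_process n S g"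
      using S s by (auto simp: sup_process_finite)
    then show "y \<le> (MAX s\<in>S. dotp n g s + a s) + (\<sigma> - 1) * sup_process n S g"
      unfolding s using \<sigma>(1) by (intro add_mono mult_left_mono) auto
  qed (use S in auto)
  have supT: "integrable (gaussian n) (sup_process n T)" and supS: "integrable (gaussian n) (sup_process n S)"
    using integrable_Max_dotp[OF T, of n] integrable_Max_dotp[OF S, of n]
    by (simp_all flip: sup_process_finite[OF T] sup_process_finite[OF S])
  have h_meas [measurable]: "h \<in> borel_measurable (gaussian n)"
    unfolding h_def by (rule measurable_Max_affine[OF S(1)])
  have D_meas [measurable]: "D \<in> borel_measurable (gaussian n)"
    unfolding D_def using supT by auto
  have supT2: "integrable (gaussian n) (\<lambda>g. (sup_process n T g)\<^sup>2)"
    using integrable_square_Max_affine[OF T, of n "\<lambda>_. 0"] T by (simp add: sup_process_finite)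
  have h2: "integrable (gaussian n) (\<lambda>g. (h g)\<^sup>2)"
    unfolding h_def by (rule integrable_square_Max_affine[OF S])
  have "integrable (gaussian n) (\<lambda>g. (sup_process n T g + - h g)\<^sup>2)"
    using supT supT2 h2
    by (intro integrable_square_add) auto
  then have D2: "integrable (gaussian n) (\<lambda>g. (D g)\<^sup>2)"
    by (simp add: D_def)
  have "sqrt (\<integral>g. (D g)\<^sup>2 \<partial>gaussian n) \<le> \<epsilon>"
    using approx by (simp add: gaussian_L2_norm_def D_def h_def)
  then have norm: "(\<integral>g. (D g)\<^sup>2 \<partial>gaussian n) \<le> \<epsilon>\<^sup>2"
    by (rule sqrt_le_D)
  have "0 < \<sigma>" using \<sigma>(1) by simp
  note diff = gaussian_dilation_difference[OF D_meas D2 norm \<epsilon> \<open>0 < \<sigma>\<close> \<sigma>(2,3)]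
  have "(\<sigma> - 1) * (gaussian_width n T - gaussian_width n S) =
        (\<integral>g. (\<sigma> - 1) * (sup_process n T g - sup_process n S g) \<partial>gaussian n)"
    using supT supS by (simp add: gaussian_width_def)
  \<comment> \<open>Subtracting \<open>h_dilate\<close> from \<open>sup_dilate\<close> gives this
    inequality pointwise, and the offsets \<open>a\<close> have dropped out.\<close>
  also have "\<dots> \<le> (\<integral>g. D (dilate n \<sigma> g) - D g \<partial>gaussian n)"
  proof (rule integral_mono)
    fix g
    show "(\<sigma> - 1) * (sup_process n T g - sup_process n S g) \<le> D (dilate n \<sigma> g) - D g"
      using h_dilate[of g] by (simp add: D_def sup_dilate algebra_simps)
  qed (use diff supT supS in auto)
  also have "\<dots> \<le> \<epsilon>" by (rule diff(3))
  finally show ?thesis .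
qed

section \<open>The scaled discrete cube\<close>

text \<open>The vertices have the same support function as the solid cube, but they form a finite
  set whose points all have the same norm.\<close>

definition cube_vertices :: "nat \<Rightarrow> real \<Rightarrow> (nat \<Rightarrow> real) set" where
  "cube_vertices n r = {..<n} \<rightarrow>\<^sub>E {- r, r}"

lemma finite_cube_vertices: "finite (cube_vertices n r)"
  by (simp add: cube_vertices_def finite_PiE)

lemma cube_vertices_nonempty: "cube_vertices n r \<noteq> {}"
  by (simp add: cube_vertices_def PiE_eq_empty_iff)

lemma sum_square_cube_vertices: "t \<in> cube_vertices n r \<Longrightarrow> (\<Sum>i<n. (t i)\<^sup>2) = real n * r\<^sup>2"
proof -
  assume "t \<in> cube_vertices n r"
  then have "t i = - r \<or> t i = r" if "i < n" for i
    using that by (auto simp: cube_vertices_def PiE_iff)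
  then have "(t i)\<^sup>2 = r\<^sup>2" if "i < n" for i
    using that by (metis power2_minus)
  then show ?thesis by simp
qed

lemma bounded_in_cube_vertices: "bounded_in n (cube_vertices n r)"
  unfolding bounded_in_def
proof (intro conjI exI ballI)
  show "cube_vertices n r \<subseteq> euclid n"
    by (auto simp: cube_vertices_def euclid_def PiE_iff)
  show "L2_set t {..<n} \<le> sqrt (real n * r\<^sup>2)" if "t \<in> cube_vertices n r" for t
    using that by (simp add: L2_set_def sum_square_cube_vertices)
qed

text \<open>The coordinates of a vertex are chosen independently, so the best vertex copies the
  signs of \<open>g\<close> and the supremum is \<open>r\<close> times the l1 norm of
  \<open>g\<close>.\<close>

lemma sup_process_cube_vertices:
  assumes "0 \<le> r"
  shows "sup_process n (cube_vertices n r) g = r * (\<Sum>i<n. \<bar>g i\<bar>)"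
  unfolding sup_process_finite[OF finite_cube_vertices cube_vertices_nonempty]
proof (rule Max_eqI)
  fix y assume "y \<in> dotp n g ` cube_vertices n r"
  then obtain t where t: "t \<in> cube_vertices n r" "y = dotp n g t" by auto
  have "g i * t i \<le> r * \<bar>g i\<bar>" if "i < n" for i
  proof -
    have "t i = - r \<or> t i = r"
      using t that by (auto simp: cube_vertices_def PiE_iff)
    then have "\<bar>g i * t i\<bar> = r * \<bar>g i\<bar>"
      using assms by (auto simp: abs_mult)
    then show ?thesis by linarith
  qed
  then show "y \<le> r * (\<Sum>i<n. \<bar>g i\<bar>)"
    unfolding t dotp_def sum_distrib_left by (intro sum_mono) auto
next
  let ?t = "\<lambda>i\<in>{..<n}. if g i \<ge> 0 then r else - r"
  have "?t \<in> cube_vertices n r"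
    by (auto simp: cube_vertices_def)
  moreover have "dotp n g ?t = r * (\<Sum>i<n. \<bar>g i\<bar>)"
    unfolding dotp_def sum_distrib_left by (intro sum.cong) auto
  ultimately show "r * (\<Sum>i<n. \<bar>g i\<bar>) \<in> dotp n g ` cube_vertices n r"
    by (metis imageI)
qed (simp add: finite_cube_vertices)

text \<open>The factor \<open>sqrt (2 / pi)\<close> is the first absolute moment of a standard
  normal variable.\<close>

lemma gaussian_width_cube_vertices:
  assumes "0 \<le> r"
  shows "gaussian_width n (cube_vertices n r) = r * real n * sqrt (2 / pi)"
proof -
  have "integrable std_normal_distribution (\<lambda>x. \<bar>x\<bar>)"
    using integrable_std_normal_distribution_moment[of 1] by auto
  moreover have "(\<integral>x. \<bar>x\<bar> \<partial>std_normal_distribution) = sqrt (2 / pi)"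
    using std_normal_distribution_odd_moments_abs[of 0] by simp
  ultimately have "integrable (gaussian n) (\<lambda>g. \<bar>g i\<bar>)" "(\<integral>g. \<bar>g i\<bar> \<partial>gaussian n) = sqrt (2 / pi)"
    if "i < n" for i
    using that by (simp_all add: gaussian_component)
  then show ?thesis
    using assms by (simp add: gaussian_width_def sup_process_cube_vertices)
qed

lemma gaussian_width_cube_vertices_normalized:
  assumes "1 \<le> n"
  shows "gaussian_width n (cube_vertices n (sqrt (pi / 2) / real n)) = 1"
proof -
  have "sqrt (pi / 2) * sqrt (2 / pi) = 1"
    by (simp flip: real_sqrt_mult)
  then show ?thesis
    using assms by (simp add: gaussian_width_cube_vertices)
qed

section \<open>Cardinality bound and choice of constants\<close>

text \<open>If \<open>S\<close> had fewer than \<open>exp (n / 16)\<close> points, its width would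
  be at most 1/2. The width gap with \<sigma> = 1 + \<delta> then gives
  \<open>\<delta> / 2 \<le> \<epsilon>\<close>, contradicting \<open>small\<close>.\<close>

lemma card_ge_if_cube_approx:
  assumes n: "1 \<le> n" and T: "T = cube_vertices n (sqrt (pi / 2) / real n)" and \<epsilon>: "0 < \<epsilon>"
    and small: "real n * \<epsilon>\<^sup>2 < 1 / 100"
    and S: "S \<subseteq> T" "S \<noteq> {}"
    and approx: "gaussian_L2_norm n (\<lambda>g. sup_process n T g - (MAX s\<in>S. dotp n g s + a s)) \<le> \<epsilon>"
  shows "exp (real n / 16) \<le> real (card S)"
proof (rule ccontr)
  assume "\<not> exp (real n / 16) \<le> real (card S)"
  then have card: "real (card S) < exp (real n / 16)" by simp
  have finS: "finite S"
    using S(1) T finite_cube_vertices by (auto intro: finite_subset)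
  have "0 < card S" using finS S(2) by (simp add: card_gt_0_iff)
  define r where "r = sqrt (pi / 2) / real n"
  \<comment> \<open>Of the order \<open>1 / sqrt n\<close> at which the second moment bound applies;
    the factor 5 gives \<open>n * (\<delta> / 2)^2 = 1/100\<close>, the threshold in
    \<open>small\<close>.\<close>
  define \<delta> where "\<delta> = 1 / (5 * sqrt (real n))"
  have sn: "1 \<le> sqrt (real n)" "(sqrt (real n))\<^sup>2 = real n" using n by auto
  have \<delta>: "0 < \<delta>" "\<delta> \<le> 1 / 5" "real n * \<delta>\<^sup>2 = 1 / 25"
    using n sn by (auto simp: \<delta>_def power_divide power_mult_distrib field_simps)
  have "real n * ((1 + \<delta>)\<^sup>2 - 1)\<^sup>2 = real n * \<delta>\<^sup>2 * (2 + \<delta>)\<^sup>2"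
    by algebra
  also have "\<dots> \<le> 1 / 25 * (2 + 1 / 5)\<^sup>2"
    unfolding \<delta>(3) using \<delta> by (intro mult_left_mono power_mono) auto
  finally have \<sigma>: "real n * ((1 + \<delta>)\<^sup>2 - 1)\<^sup>2 \<le> 1 / 2"
    by (simp add: power2_eq_square)
  have wT: "gaussian_width n T = 1"
    unfolding T by (rule gaussian_width_cube_vertices_normalized[OF n])
  have "finite T" "T \<noteq> {}"
    unfolding T by (simp_all add: finite_cube_vertices cube_vertices_nonempty)
  from gaussian_width_gap[OF this finS S(2) approx \<epsilon> _ \<sigma> n] \<delta> wT
  have gap: "\<delta> * (1 - gaussian_width n S) \<le> \<epsilon>" by simp
  have rad: "(\<Sum>i<n. (s i)\<^sup>2) \<le> 2 / real n" if "s \<in> S" for s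
  proof -
    have "(\<Sum>i<n. (s i)\<^sup>2) = real n * r\<^sup>2"
      using that S(1) sum_square_cube_vertices unfolding T r_def by blast
    also have "\<dots> = (pi / 2) / real n"
      using n by (simp add: r_def power_divide power2_eq_square)
    also have "\<dots> \<le> 2 / real n"
      using pi_less_4 by (intro divide_right_mono) auto
    finally show ?thesis .
  qed
  \<comment> \<open>The choice \<open>u = n / 4\<close> minimises the bound when
    \<open>ln (card S)\<close> is replaced by \<open>n / 16\<close>: the cardinality term and the
    norm term are then 1/4 each.\<close>
  have "gaussian_width n S \<le> (ln (card S) + (real n / 4)\<^sup>2 * (2 / real n) / 2) / (real n / 4)"
    using n by (intro gaussian_width_finite_le finS S(2) rad) auto
  also have "\<dots> \<le> (real n / 16 + (real n / 4)\<^sup>2 * (2 / real n) / 2) / (real n / 4)"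
  proof -
    have "ln (card S) \<le> real n / 16"
      using card \<open>0 < card S\<close> ln_less_cancel_iff[of "real (card S)" "exp (real n / 16)"] by simp
    then show ?thesis by (intro divide_right_mono add_right_mono) auto
  qed
  also have "\<dots> = 1 / 2"
    using n by (simp add: field_simps power2_eq_square)
  finally have "\<delta> * (1 / 2) \<le> \<delta> * (1 - gaussian_width n S)"
    using \<delta> by (intro mult_left_mono) auto
  with gap have "\<delta> / 2 \<le> \<epsilon>" by simp
  then have "(\<delta> / 2)\<^sup>2 \<le> \<epsilon>\<^sup>2" using \<delta> by (intro power_mono) auto
  then have "real n * (\<delta> / 2)\<^sup>2 \<le> real n * \<epsilon>\<^sup>2" by (intro mult_left_mono) auto
  moreover have "real n * (\<delta> / 2)\<^sup>2 = 1 / 100"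
    using \<delta>(3) by (simp add: power_divide)
  ultimately show False using small by simp
qed

theorem theorem2:
  shows "\<exists>\<epsilon>\<^sub>0 > (0::real). \<exists>c > (0::real). \<forall>\<epsilon>::real. 0 < \<epsilon> \<and> \<epsilon> < \<epsilon>\<^sub>0 \<longrightarrow>
    (\<exists>(n::nat) (T :: (nat \<Rightarrow> real) set).
       1 \<le> n \<and> T \<noteq> {} \<and> bounded_in n T \<and> gaussian_width n T = 1 \<and>
       (\<forall>(S :: (nat \<Rightarrow> real) set) (a :: (nat \<Rightarrow> real) \<Rightarrow> real).
          S \<subseteq> T \<and> finite S \<and> S \<noteq> {} \<and>
          gaussian_L2_norm n (\<lambda>g. sup_process n T g - (MAX s\<in>S. dotp n g s + a s)) \<le> \<epsilon>
          \<longrightarrow> exp (c / \<epsilon>\<^sup>2) \<le> real (card S)))"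
proof (rule exI[of _ "1 / 25"], intro conjI, simp, rule exI[of _ "1 / 3200"], intro conjI, simp,
    intro allI impI, elim conjE)
  fix \<epsilon> :: real
  assume \<epsilon>: "0 < \<epsilon>" "\<epsilon> < 1 / 25"
  \<comment> \<open>The largest integer with \<open>n * \<epsilon>^2 \<le> 1/150\<close>, which
    leaves room below the 1/100 required by \<open>small\<close>.\<close>
  define n where "n = nat \<lfloor>1 / (150 * \<epsilon>\<^sup>2)\<rfloor>"
  define T where "T = cube_vertices n (sqrt (pi / 2) / real n)"
  have "\<epsilon>\<^sup>2 \<le> (1 / 25)\<^sup>2" using \<epsilon> by (intro power_mono) auto
  then have e2: "0 < \<epsilon>\<^sup>2" "\<epsilon>\<^sup>2 \<le> 1 / 625" using \<epsilon> by (auto simp: power2_eq_square)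
  \<comment> \<open>For \<epsilon> below 1/25 the loss of at most 1 in the floor is covered by
    \<open>1 / (600 * \<epsilon>^2)\<close>. Hence \<open>n\<close> is at least
    \<open>1 / (200 * \<epsilon>^2)\<close>, and dividing by 16 gives the constant 1/3200.\<close>
  have "1 \<le> 1 / (600 * \<epsilon>\<^sup>2)" "1 \<le> 1 / (150 * \<epsilon>\<^sup>2)"
    using e2 by (simp_all add: field_simps)
  then have n: "1 \<le> n" "real n \<le> 1 / (150 * \<epsilon>\<^sup>2)" "1 / (150 * \<epsilon>\<^sup>2) - 1 / (600 * \<epsilon>\<^sup>2) \<le> real n"
    unfolding n_def by linarith+
  have small: "real n * \<epsilon>\<^sup>2 < 1 / 100" and large: "1 / 3200 / \<epsilon>\<^sup>2 \<le> real n / 16"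
    using n e2 by (auto simp: field_simps)
  show "\<exists>(n::nat) (T :: (nat \<Rightarrow> real) set).
       1 \<le> n \<and> T \<noteq> {} \<and> bounded_in n T \<and> gaussian_width n T = 1 \<and>
       (\<forall>(S :: (nat \<Rightarrow> real) set) (a :: (nat \<Rightarrow> real) \<Rightarrow> real).
          S \<subseteq> T \<and> finite S \<and> S \<noteq> {} \<and>
          gaussian_L2_norm n (\<lambda>g. sup_process n T g - (MAX s\<in>S. dotp n g s + a s)) \<le> \<epsilon>
          \<longrightarrow> exp (1 / 3200 / \<epsilon>\<^sup>2) \<le> real (card S))"
  proof (intro exI[of _ n] exI[of _ T] conjI allI impI n(1))
    show "T \<noteq> {}" "bounded_in n T"
      unfolding T_def by (rule cube_vertices_nonempty bounded_in_cube_vertices)+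
    show "gaussian_width n T = 1"
      unfolding T_def by (rule gaussian_width_cube_vertices_normalized[OF n(1)])
  next
    fix S a
    assume "S \<subseteq> T \<and> finite S \<and> S \<noteq> {} \<and>
      gaussian_L2_norm n (\<lambda>g. sup_process n T g - (MAX s\<in>S. dotp n g s + a s)) \<le> \<epsilon>"
    then have "exp (real n / 16) \<le> real (card S)"
      using card_ge_if_cube_approx[OF n(1) T_def \<epsilon>(1) small] by blast
    moreover have "exp (1 / 3200 / \<epsilon>\<^sup>2) \<le> exp (real n / 16)"
      using large by simp
    ultimately show "exp (1 / 3200 / \<epsilon>\<^sup>2) \<le> real (card S)" by linarith
  qed
qed

end
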